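(* Let $S=K[t_1,\ldots,t_s]$ be a polynomial ring over a field $K$, let $I=(t^{v_1},\ldots,t^{v_q})$ be a monomial ideal of $S$, let $A$ be its incidence matrix, and let $t^\alpha$ be a monomial in $S$. The following are equivalent. (a) $t^\alpha\in\overline{I^n}$, $n\geq 1$. (b) $A\lambda\leq\alpha$ for some $\lambda\in\mathbb{Q}_+^q$ with $|\lambda|\geq n$. (c) $\max\{\langle y,1\rangle\mid y\geq 0;\, Ay\leq\alpha\}=\min\{\langle\alpha,x\rangle\mid x\geq 0;\, xA\geq 1\}\geq n$.
   Context: $\mathbb{N}=\{0,1,2,\ldots\}$ and $\mathbb{Q}_+$ is the set of nonnegative rational numbers. For $a=(a_1,\ldots,a_s)\in\mathbb{N}^s$, $t^a:=t_1^{a_1}\cdots t_s^{a_s}$. Here $\{t^{v_1},\ldots,t^{v_q}\}$ is the minimal set of monomial generators of $I$, with $v_i\in\mathbb{N}^s\setminus\{0\}$ for all $i$, and the incidence matrix $A$ of $I$ is the $s\times q$ matrix with column vectors $v_1,\ldots,v_q$. The integer $n\geq 1$ is the same in (a), (b) and (c). $\overline{I^n}$ is the integral closure of $I^n$. For a vector $c$, $|c|$ is the sum of its entries; $\langle\ ,\,\rangle$ is the ordinary inner product; $1=(1,\ldots,1)$; inequalities between vectors are entrywise. In (c), $y$ ranges over $\mathbb{R}^q$ (column vectors) and $x$ ranges over $\mathbb{R}^s$ (row vectors). *)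

theory Defs
  imports "HOL-Analysis.Analysis" "HOL-Library.Poly_Mapping"
begin

text \<open>The polynomial ring \<open>K[t\<^sub>1,\<dots>,t\<^sub>s]\<close> is rendered as the type
  \<open>(nat ^ 's) \<Rightarrow>\<^sub>0 'k\<close> of finitely supported functions from exponent vectors to
  coefficients, with the convolution product of \<^theory>\<open>HOL-Library.Poly_Mapping\<close>;
  \<open>'s\<close> is the finite index type of the variables.\<close>

definition indet :: "'s::finite \<Rightarrow> (nat ^ 's) \<Rightarrow>\<^sub>0 'k::comm_ring_1" where
  "indet i = Poly_Mapping.single (axis i 1) 1"

definition mon :: "nat ^ 's \<Rightarrow> (nat ^ 's::finite) \<Rightarrow>\<^sub>0 'k::comm_ring_1" where
  "mon a = (\<Prod>i\<in>UNIV. indet i ^ (a $ i))"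

text \<open>An ideal is a submodule of the ring over itself.\<close>

definition ideal_gen :: "'r::comm_ring_1 set \<Rightarrow> 'r set" where
  "ideal_gen B = module.span (*) B"

fun ideal_power :: "'r::comm_ring_1 set \<Rightarrow> nat \<Rightarrow> 'r set" where
  "ideal_power I 0 = UNIV"
| "ideal_power I (Suc n) = ideal_gen {a * b | a b. a \<in> I \<and> b \<in> ideal_power I n}"

text \<open>Integral closure of an ideal: all \<open>f\<close> satisfying a monic equation
  \<open>f^m + a\<^sub>1 f^(m-1) + \<dots> + a\<^sub>m = 0\<close> with \<open>m \<ge> 1\<close> and \<open>a\<^sub>i\<close> in the
  \<open>i\<close>-th power of the ideal.\<close>

definition ideal_integral_closure :: "'r::comm_ring_1 set \<Rightarrow> 'r set" where
  "ideal_integral_closure J =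
     {f. \<exists>m\<ge>1. \<exists>a. (\<forall>i\<in>{1..m}. a i \<in> ideal_power J i) \<and>
           f ^ m + (\<Sum>i=1..m. a i * f ^ (m - i)) = 0}"

definition minimal_monomial_generators ::
  "((nat ^ 's::finite) \<Rightarrow>\<^sub>0 'k::comm_ring_1) set \<Rightarrow> ((nat ^ 's) \<Rightarrow>\<^sub>0 'k) set \<Rightarrow> bool" where
  "minimal_monomial_generators G I \<longleftrightarrow>
     G \<subseteq> range mon \<and> ideal_gen G = I \<and> (\<forall>H. H \<subset> G \<longrightarrow> ideal_gen H \<noteq> I)"

definition of_nat_vec :: "nat ^ 's \<Rightarrow> 'a::semiring_1 ^ 's" where
  "of_nat_vec a = (\<chi> i. of_nat (a $ i))"

text \<open>Rows are indexed by the variables and columns by the generators; the entries are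
  embedded in an arbitrary semiring, so that the matrix can act on rational as well as on
  real vectors.\<close>

definition incidence_matrix :: "('q \<Rightarrow> nat ^ 's) \<Rightarrow> 'a::semiring_1 ^ 'q ^ 's" where
  "incidence_matrix v = (\<chi> i j. of_nat (v j $ i))"

text \<open>Extrema of possibly infinite sets, including that they are attained
  (\<^const>\<open>Max\<close> and \<^const>\<open>Min\<close> are only meaningful on finite sets).\<close>

definition is_max_of :: "real \<Rightarrow> real set \<Rightarrow> bool" where
  "is_max_of m X \<longleftrightarrow> m \<in> X \<and> (\<forall>z\<in>X. z \<le> m)"

definition is_min_of :: "real \<Rightarrow> real set \<Rightarrow> bool" where
  "is_min_of m X \<longleftrightarrow> m \<in> X \<and> (\<forall>z\<in>X. m \<le> z)"

end

theory Submission imports Defs begin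

text \<open>Write \<open>I\<close> for the ideal generated by the monomials with exponents \<open>v j\<close>. All three conditions
are compared with one statement about integers: for some \<open>d \<ge> 1\<close>, the monomial \<open>t\<^sup>d\<^sup>\<alpha>\<close> is divisible
by a product of at least \<open>d n\<close> generators, that is, \<open>t\<^sup>d\<^sup>\<alpha> \<in> I\<^sup>d\<^sup>n\<close>.

For the integral closure (\<open>mon_in_integral_closure_iff\<close>), an equation of integral dependence
of degree \<open>m\<close> must cancel the monomial \<open>t\<^sup>m\<^sup>\<alpha>\<close>. Hence \<open>t\<^sup>i\<^sup>\<alpha>\<close> occurs in a coefficient from
\<open>(I\<^sup>n)\<^sup>i\<close> for some \<open>i \<ge> 1\<close>, and \<open>d = i\<close> works. Conversely, \<open>t\<^sup>d\<^sup>\<alpha> \<in> (I\<^sup>n)\<^sup>d\<close> makes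
\<open>t\<^sup>\<alpha>\<close> a root of \<open>X\<^sup>d - t\<^sup>d\<^sup>\<alpha>\<close>.

Dividing the multiplicities of the generators by \<open>d\<close> gives a rational point \<open>\<lambda> \<ge> 0\<close> with
\<open>A \<lambda> \<le> \<alpha>\<close> and \<open>|\<lambda>| \<ge> n\<close>, which is in particular a real one. The circle is closed by
\<open>integral_solution_of_scaled_packing\<close>: a real point with these properties is multiplied by a
suitable \<open>d\<close> and rounded to integers by means of Dirichlet's simultaneous approximation theorem,
and since all data are integral a small enough rounding error breaks none of the inequalities.

Finally, the existence of a real point of value at least \<open>n\<close> says that the maximum of the packing
program, attained by compactness, is at least \<open>n\<close>. That this maximum is also the minimum of the
covering program is linear programming duality, proved in \<open>lp_strong_duality\<close> by separating a
point from a finitely generated cone.\<close>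

section \<open>Monomials and powers of ideals\<close>

lemma module_mult: "module ((*) :: 'r::comm_ring_1 \<Rightarrow> 'r \<Rightarrow> 'r)"
  by unfold_locales (auto simp: algebra_simps)

lemma ideal_gen_base: "x \<in> B \<Longrightarrow> x \<in> ideal_gen B"
  unfolding ideal_gen_def by (rule module.span_base[OF module_mult])

lemma ideal_gen_absorb: "x \<in> ideal_gen B \<Longrightarrow> r * x \<in> ideal_gen B"
  unfolding ideal_gen_def by (rule module.span_scale[OF module_mult])

lemma ideal_gen_least:
  assumes "B \<subseteq> J" "0 \<in> J" "\<And>f g. f \<in> J \<Longrightarrow> g \<in> J \<Longrightarrow> f + g \<in> J" "\<And>r f. f \<in> J \<Longrightarrow> r * f \<in> J"
  shows "ideal_gen B \<subseteq> J"
  unfolding ideal_gen_def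
  by (rule module.span_minimal[OF module_mult]) (use assms in \<open>auto simp: module.subspace_def[OF module_mult]\<close>)

lemma ideal_power_absorb:
  assumes "x \<in> ideal_power J k"
  shows "r * x \<in> ideal_power J k"
  using assms by (cases k) (auto intro: ideal_gen_absorb)

lemma ideal_power_SucI: "x \<in> J \<Longrightarrow> y \<in> ideal_power J k \<Longrightarrow> x * y \<in> ideal_power J (Suc k)"
  by (auto intro!: ideal_gen_base)

lemma prod_list_in_ideal_power:
  assumes "set xs \<subseteq> J" "n \<le> length xs"
  shows "prod_list xs \<in> ideal_power J n"
  using assms
proof (induction n arbitrary: xs)
  case (Suc n)
  then obtain x ys where "xs = x # ys" by (cases xs) auto
  with Suc show ?case by (auto intro!: ideal_power_SucI simp del: ideal_power.simps)
qed simp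

text \<open>The list is cut into blocks of length \<open>n\<close>. For products of elements of \<open>J\<close>
this is the inclusion \<open>J\<^sup>d\<^sup>n \<subseteq> (J\<^sup>n)\<^sup>d\<close>.\<close>

lemma prod_list_in_iterated_ideal_power:
  assumes "set xs \<subseteq> J" "d * n \<le> length xs"
  shows "prod_list xs \<in> ideal_power (ideal_power J n) d"
  using assms
proof (induction d arbitrary: xs)
  case (Suc d)
  have "prod_list (take n xs) * prod_list (drop n xs) \<in> ideal_power (ideal_power J n) (Suc d)"
  proof (rule ideal_power_SucI)
    show "prod_list (take n xs) \<in> ideal_power J n"
      using Suc.prems set_take_subset[of n xs] by (intro prod_list_in_ideal_power) auto
    show "prod_list (drop n xs) \<in> ideal_power (ideal_power J n) d"
      using Suc.prems set_drop_subset[of n xs] by (intro Suc.IH) auto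
  qed
  then show ?case by (simp only: prod_list.append[symmetric] append_take_drop_id)
qed simp

text \<open>Turns a monomial in the generators into a list of factors, to which
\<open>prod_list_in_iterated_ideal_power\<close> applies.\<close>

lemma prod_power_as_prod_list:
  fixes f :: "'a \<Rightarrow> 'r::comm_monoid_mult"
  assumes "finite A"
  shows "\<exists>xs. set xs \<subseteq> f ` A \<and> length xs = sum c A \<and> prod_list xs = (\<Prod>j\<in>A. f j ^ c j)"
  using assms
proof induction
  case (insert a A)
  then obtain xs where "set xs \<subseteq> f ` A" "length xs = sum c A" "prod_list xs = (\<Prod>j\<in>A. f j ^ c j)"
    by blast
  with insert show ?case
    by (intro exI[of _ "replicate (c a) (f a) @ xs"]) (auto simp: prod_list_replicate)
qed simp

lemma single_power: "Poly_Mapping.single a (1::'k::comm_ring_1) ^ n = Poly_Mapping.single (of_nat n *s a) 1"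
  for a :: "nat ^ 's"
  by (induction n)
    (auto simp: mult_single vec_eq_iff single_one[symmetric] algebra_simps simp del: single_one intro!: arg_cong[of _ _ "\<lambda>a. Poly_Mapping.single a _"])

lemma prod_single:
  "(\<Prod>i\<in>A. Poly_Mapping.single (f i) (1::'k::comm_ring_1)) = Poly_Mapping.single (\<Sum>i\<in>A. f i) 1"
  by (induction A rule: infinite_finite_induct) (auto simp: mult_single)

lemma mon_eq_single: "mon a = Poly_Mapping.single a 1"
proof -
  have "(\<Sum>i\<in>UNIV. of_nat (a $ i) *s axis i 1) = a"
    by (simp add: vec_eq_iff axis_def if_distrib cong: if_cong)
  then show ?thesis
    by (simp add: mon_def indet_def single_power prod_single)
qed

lemma mon_add: "mon (a + b) = mon a * mon b"
  by (simp add: mon_eq_single mult_single)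

lemma mon_sum: "mon (sum f A) = (\<Prod>i\<in>A. mon (f i))"
  by (simp add: mon_eq_single prod_single)

lemma mon_power: "mon a ^ k = mon (k *s a)"
  by (simp add: mon_eq_single single_power)

lemma keys_mon: "Poly_Mapping.keys (mon a :: _ \<Rightarrow>\<^sub>0 'k::field) = {a}"
  by (simp add: mon_eq_single)

section \<open>Exponents in powers of a monomial ideal\<close>

text \<open>The exponents of the monomials in \<open>I\<^sup>k\<close>, where \<open>I\<close> is generated by the monomials with
exponents \<open>v j\<close>. Asking for at least \<open>k\<close> factors instead of exactly \<open>k\<close> gives
the same set and spares a choice of factors to discard.\<close>

definition power_exponents :: "('q::finite \<Rightarrow> nat ^ 's) \<Rightarrow> nat \<Rightarrow> (nat ^ 's) set" where
  "power_exponents v k = {\<beta>. \<exists>c. k \<le> sum c UNIV \<and> (\<Sum>j\<in>UNIV. c j *s v j) \<le> \<beta>}"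

lemma power_exponents_0: "power_exponents v 0 = UNIV"
  by (auto simp: power_exponents_def less_eq_vec_def intro!: exI[of _ "\<lambda>_. 0"])

lemma power_exponents_add:
  assumes "a \<in> power_exponents v k" "b \<in> power_exponents v l"
  shows "a + b \<in> power_exponents v (k + l)"
proof -
  from assms obtain c d where "k \<le> sum c UNIV" "(\<Sum>j\<in>UNIV. c j *s v j) \<le> a"
      "l \<le> sum d UNIV" "(\<Sum>j\<in>UNIV. d j *s v j) \<le> b"
    by (auto simp: power_exponents_def)
  then show ?thesis
    unfolding power_exponents_def
    by (auto intro!: exI[of _ "\<lambda>j. c j + d j"] simp: sum.distrib less_eq_vec_def algebra_simps add_mono)
qed

lemma power_exponents_generator: "v j \<in> power_exponents v 1"
proof -
  have "(\<Sum>i\<in>UNIV. (if i = j then 1 else 0) *s v i) = v j"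
    by (simp add: vec_eq_iff if_distrib[of "\<lambda>x. x * _"] cong: if_cong)
  then show ?thesis
    by (auto simp: power_exponents_def intro!: exI[of _ "\<lambda>i. if i = j then 1 else 0"])
qed

text \<open>Multiplication by a polynomial translates exponents, so polynomials supported in a
translation-stable set of exponents form an ideal.\<close>

lemma ideal_gen_keys:
  fixes B :: "('a::comm_monoid_add \<Rightarrow>\<^sub>0 'k::comm_ring_1) set"
  assumes "f \<in> ideal_gen B" "\<And>f. f \<in> B \<Longrightarrow> Poly_Mapping.keys f \<subseteq> U" "\<And>a b. b \<in> U \<Longrightarrow> a + b \<in> U"
  shows "Poly_Mapping.keys f \<subseteq> U"
proof -
  have "ideal_gen B \<subseteq> {f. Poly_Mapping.keys f \<subseteq> U}"
  proof (rule ideal_gen_least)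
    fix f g :: "'a \<Rightarrow>\<^sub>0 'k"
    show "f \<in> {f. Poly_Mapping.keys f \<subseteq> U} \<Longrightarrow> g \<in> {f. Poly_Mapping.keys f \<subseteq> U} \<Longrightarrow>
      f + g \<in> {f. Poly_Mapping.keys f \<subseteq> U}"
      using keys_add[of f g] by auto
    show "f \<in> {f. Poly_Mapping.keys f \<subseteq> U} \<Longrightarrow> g * f \<in> {f. Poly_Mapping.keys f \<subseteq> U}"
      using keys_mult[of g f] assms(3) by fastforce
  qed (use assms(2) in auto)
  then show ?thesis using assms(1) by auto
qed

lemma power_exponents_upward: "b \<in> power_exponents v k \<Longrightarrow> a + b \<in> power_exponents v k"
  using power_exponents_add[of a v 0 b k] by (simp add: power_exponents_0)

lemma keys_ideal_power:
  assumes "\<And>f. f \<in> J \<Longrightarrow> Poly_Mapping.keys f \<subseteq> power_exponents v a" "f \<in> ideal_power J k"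
  shows "Poly_Mapping.keys f \<subseteq> power_exponents v (k * a)"
  using assms(2)
proof (induction k arbitrary: f)
  case 0
  then show ?case by (simp add: power_exponents_0)
next
  case (Suc k)
  have prod: "Poly_Mapping.keys (g * h) \<subseteq> power_exponents v (Suc k * a)" if "g \<in> J" "h \<in> ideal_power J k" for g h
    using keys_mult[of g h] assms(1)[OF that(1)] Suc.IH[OF that(2)] power_exponents_add[of _ v a _ "k * a"]
    by fastforce
  have "f \<in> ideal_gen {g * h | g h. g \<in> J \<and> h \<in> ideal_power J k}"
    using Suc.prems by simp
  then show ?case
    by (rule ideal_gen_keys) (use prod power_exponents_upward in blast)+
qed

text \<open>In an equation of integral dependence for \<open>t\<^sup>\<alpha>\<close> the monomial \<open>t\<^sup>m\<^sup>\<alpha>\<close> must cancel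
against some \<open>a\<^sub>i t\<^bsup>(m-i)\<alpha>\<^esup>\<close>, and this forces \<open>t\<^sup>i\<^sup>\<alpha>\<close> to occur in \<open>a\<^sub>i\<close>.\<close>

lemma integral_mon_imp_key:
  fixes J :: "((nat ^ 's::finite) \<Rightarrow>\<^sub>0 'k::field) set"
  assumes "mon \<alpha> \<in> ideal_integral_closure J"
  shows "\<exists>i\<ge>1. \<exists>f\<in>ideal_power J i. i *s \<alpha> \<in> Poly_Mapping.keys f"
proof -
  obtain m a where m: "m \<ge> 1" and a: "\<And>i. i \<in> {1..m} \<Longrightarrow> a i \<in> ideal_power J i"
    and eq: "mon \<alpha> ^ m + (\<Sum>i=1..m. a i * mon \<alpha> ^ (m - i)) = 0"
    using assms unfolding ideal_integral_closure_def by blast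
  have "mon \<alpha> ^ m = - (\<Sum>i=1..m. a i * mon \<alpha> ^ (m - i))"
    using eq by (simp only: eq_neg_iff_add_eq_0)
  then have "- (\<Sum>i=1..m. a i * mon \<alpha> ^ (m - i)) = mon (m *s \<alpha>)"
    by (simp only: mon_power)
  then have "m *s \<alpha> \<in> Poly_Mapping.keys (- (\<Sum>i=1..m. a i * mon \<alpha> ^ (m - i)))"
    by (simp add: keys_mon)
  then have "m *s \<alpha> \<in> Poly_Mapping.keys (\<Sum>i=1..m. a i * mon ((m - i) *s \<alpha>))"
    by (simp add: mon_power in_keys_iff)
  then obtain i where i: "i \<in> {1..m}" "m *s \<alpha> \<in> Poly_Mapping.keys (a i * mon ((m - i) *s \<alpha>))"
    using keys_sum[of "\<lambda>i. a i * mon ((m - i) *s \<alpha>)" "{1..m}"] by blast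
  then obtain b where b: "b \<in> Poly_Mapping.keys (a i)" "m *s \<alpha> = b + (m - i) *s \<alpha>"
    using keys_mult[of "a i" "mon ((m - i) *s \<alpha>)"] by (auto simp: keys_mon)
  have "m *s \<alpha> = i *s \<alpha> + (m - i) *s \<alpha>"
    using i(1) by (simp flip: vector_sadd_rdistrib)
  with b(2) have "b = i *s \<alpha>"
    by (simp only: add_right_cancel)
  with b i a[of i] show ?thesis by auto
qed

text \<open>For a monomial, integral dependence reduces to a binomial equation: some power
\<open>(t\<^sup>\<alpha>)\<^sup>d\<close> already lies in \<open>(I\<^sup>n)\<^sup>d\<close>, and in that case \<open>t\<^sup>\<alpha>\<close> is a root of
\<open>X\<^sup>d - t\<^sup>d\<^sup>\<alpha>\<close>.\<close>

lemma mon_in_integral_closure_iff: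
  fixes v :: "'q::finite \<Rightarrow> nat ^ 's::finite"
  defines "I \<equiv> ideal_gen (range (\<lambda>j. mon (v j))) :: ((nat ^ 's) \<Rightarrow>\<^sub>0 'k::field) set"
  shows "mon \<alpha> \<in> ideal_integral_closure (ideal_power I n) \<longleftrightarrow>
    (\<exists>d\<ge>1. d *s \<alpha> \<in> power_exponents v (d * n))"
proof
  assume "mon \<alpha> \<in> ideal_integral_closure (ideal_power I n)"
  then obtain i f where i: "i \<ge> 1" "f \<in> ideal_power (ideal_power I n) i" "i *s \<alpha> \<in> Poly_Mapping.keys f"
    using integral_mon_imp_key by blast
  have "Poly_Mapping.keys g \<subseteq> power_exponents v 1" if "g \<in> I" for g
    using that unfolding I_def
    by (rule ideal_gen_keys) (auto intro: power_exponents_upward power_exponents_generator simp: keys_mon simp del: One_nat_def)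
  then have "Poly_Mapping.keys g \<subseteq> power_exponents v n" if "g \<in> ideal_power I n" for g
    using keys_ideal_power[of I v 1 g n] that by simp
  then have "Poly_Mapping.keys f \<subseteq> power_exponents v (i * n)"
    using keys_ideal_power i(2) by blast
  with i show "\<exists>d\<ge>1. d *s \<alpha> \<in> power_exponents v (d * n)" by blast
next
  assume "\<exists>d\<ge>1. d *s \<alpha> \<in> power_exponents v (d * n)"
  then obtain d c where d: "d \<ge> 1" and c: "d * n \<le> sum c UNIV" "(\<Sum>j\<in>UNIV. c j *s v j) \<le> d *s \<alpha>"
    by (auto simp: power_exponents_def)
  obtain xs :: "((nat ^ 's) \<Rightarrow>\<^sub>0 'k) list" where xs: "set xs \<subseteq> range (\<lambda>j. mon (v j))" "length xs = sum c UNIV"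
      "prod_list xs = (\<Prod>j\<in>UNIV. mon (v j) ^ c j)"
    using prod_power_as_prod_list[of UNIV "\<lambda>j. mon (v j)" c] by auto
  have "prod_list xs \<in> ideal_power (ideal_power I n) d"
    using xs c by (intro prod_list_in_iterated_ideal_power) (auto simp: I_def intro!: ideal_gen_base)
  then have mem: "(- 1) * (mon \<gamma> * prod_list xs) \<in> ideal_power (ideal_power I n) d" for \<gamma>
    by (intro ideal_power_absorb)
  \<comment> \<open>Divide \<open>t\<^sup>d\<^sup>\<alpha>\<close> by the product of the generators; the quotient is a monomial.\<close>
  define \<gamma> where "\<gamma> = d *s \<alpha> - (\<Sum>j\<in>UNIV. c j *s v j)"
  have eq: "d *s \<alpha> = \<gamma> + (\<Sum>j\<in>UNIV. c j *s v j)"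
    using c(2) by (auto simp: \<gamma>_def less_eq_vec_def vec_eq_iff)
  have "mon (d *s \<alpha>) = mon \<gamma> * prod_list xs"
    unfolding eq by (simp only: mon_add mon_sum mon_power xs(3))
  with mem[of \<gamma>] have mem: "- mon (d *s \<alpha>) \<in> ideal_power (ideal_power I n) d"
    by simp
  let ?a = "\<lambda>i. if i = d then - mon (d *s \<alpha>) else (0 :: (nat ^ 's) \<Rightarrow>\<^sub>0 'k)"
  have "\<forall>i\<in>{1..d}. ?a i \<in> ideal_power (ideal_power I n) i"
  proof 
    fix i assume "i \<in> {1..d}"
    have "0 \<in> ideal_power (ideal_power I n) i" 
      by (cases i) (auto simp: ideal_gen_def module.span_zero[OF module_mult])
    with mem show "?a i \<in> ideal_power (ideal_power I n) i" by auto
  qed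
  moreover have "(\<Sum>i=1..d. ?a i * mon \<alpha> ^ (d - i)) = - mon (d *s \<alpha>)"
    using d by (simp add: if_distrib[of "\<lambda>x. x * _"] cong: if_cong)
  then have "mon \<alpha> ^ d + (\<Sum>i=1..d. ?a i * mon \<alpha> ^ (d - i)) = 0"
    by (simp add: mon_power)
  ultimately show "mon \<alpha> \<in> ideal_integral_closure (ideal_power I n)"
    using d unfolding ideal_integral_closure_def by (intro CollectI exI[of _ d] exI[of _ ?a] conjI)
qed

section \<open>Linear programming duality\<close>

lemma inner_mono_nonneg:
  fixes a b x :: "real ^ 'n"
  assumes "a \<le> b" "0 \<le> x"
  shows "a \<bullet> x \<le> b \<bullet> x"
  using assms by (auto simp: inner_vec_def less_eq_vec_def intro!: sum_mono mult_right_mono)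

lemma lp_weak_duality:
  fixes A :: "real ^ 'q ^ 's"
  assumes "0 \<le> y" "A *v y \<le> b" "0 \<le> x" "c \<le> x v* A"
  shows "c \<bullet> y \<le> b \<bullet> x"
proof -
  have "c \<bullet> y \<le> (x v* A) \<bullet> y" using assms by (intro inner_mono_nonneg)
  also have "\<dots> = (A *v y) \<bullet> x" by (metis dot_lmul_matrix inner_commute)
  also have "\<dots> \<le> b \<bullet> x" using assms by (intro inner_mono_nonneg)
  finally show ?thesis .
qed

text \<open>A form of Farkas' lemma. The conclusion says that \<open>(c, - m)\<close> belongs to the cone of all pairs
dominated by some \<open>(x v* A, - (b \<bullet> x))\<close> with \<open>x \<ge> 0\<close>. This cone is finitely generated, hence closed, so
a point outside it is cut off by a hyperplane through the origin. The normal of that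
hyperplane, up to sign, is a homogenised primal point \<open>(y, \<tau>)\<close>: if \<open>\<tau> > 0\<close> then
\<open>y / \<tau>\<close> violates the bound \<open>m\<close>, and if \<open>\<tau> = 0\<close> then \<open>y\<close> is a direction of unbounded
growth, which contradicts weak duality with the dual point \<open>x0\<close>.\<close>

lemma lp_strong_duality:
  fixes A :: "real ^ 'q ^ 's"
  assumes dual: "0 \<le> x0" "c \<le> x0 v* A"
    and bound: "\<And>y. 0 \<le> y \<Longrightarrow> A *v y \<le> b \<Longrightarrow> c \<bullet> y \<le> m"
  shows "\<exists>x\<ge>0. c \<le> x v* A \<and> b \<bullet> x \<le> m"
proof -
  define G :: "((real ^ 'q) \<times> real) set" where
    "G = range (\<lambda>i. (row i A, - b $ i)) \<union> range (\<lambda>j. (- axis j 1, 0)) \<union> {(0, -1)}"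
  define K where "K = {p. \<exists>x\<ge>0. fst p \<le> x v* A \<and> snd p \<le> - (b \<bullet> x)}"
  have "convex_cone K"
    unfolding convex_cone_iff
  proof (intro conjI ballI allI impI)
    show "0 \<in> K" by (auto simp: K_def intro!: exI[of _ 0])
  next
    fix p q assume "p \<in> K" "q \<in> K"
    then obtain x y where "0 \<le> x" "fst p \<le> x v* A" "snd p \<le> - (b \<bullet> x)"
        "0 \<le> y" "fst q \<le> y v* A" "snd q \<le> - (b \<bullet> y)"
      by (auto simp: K_def)
    then show "p + q \<in> K"
      unfolding K_def
      by (auto intro!: exI[of _ "x + y"] simp: vector_matrix_left_distrib inner_add_right less_eq_vec_def add_mono)
  next
    fix p and r :: real assume "p \<in> K" "0 \<le> r"
    then obtain x where "0 \<le> x" "fst p \<le> x v* A" "snd p \<le> - (b \<bullet> x)"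
      by (auto simp: K_def)
    with \<open>0 \<le> r\<close> show "r *\<^sub>R p \<in> K"
      unfolding K_def
      using mult_left_mono[of "snd p" "- (b \<bullet> x)" r]
      by (auto intro!: exI[of _ "r *\<^sub>R x"] simp: scaleR_vector_matrix_assoc less_eq_vec_def mult_left_mono)
  qed
  moreover have "G \<subseteq> K"
  proof -
    have "(row i A, - b $ i) \<in> K" for i
    proof -
      have "axis i 1 v* A = row i A"
        by (simp add: vec_eq_iff vector_matrix_mult_def row_def axis_def if_distrib[of "\<lambda>x. x * _"] cong: if_cong)
      moreover have "0 \<le> axis i (1 :: real)" by (simp add: less_eq_vec_def axis_def)
      ultimately show ?thesis
        unfolding K_def by (auto intro!: exI[of _ "axis i 1"] simp: inner_axis)
    qed
    moreover have "(- axis j 1, 0) \<in> K" "(0, -1) \<in> K" for j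
      by (auto simp: K_def less_eq_vec_def axis_def intro!: exI[of _ 0])
    ultimately show ?thesis by (auto simp: G_def)
  qed
  ultimately have hullK: "convex_cone hull G \<subseteq> K"
    by (intro hull_minimal)
  have "(c, - m) \<in> convex_cone hull G"
  proof (rule ccontr)
    assume "(c, - m) \<notin> convex_cone hull G"
    moreover have "closed (convex_cone hull G)"
      by (rule closed_convex_cone_hull) (auto simp: G_def)
    ultimately obtain u e where u: "u \<bullet> (c, - m) < e" "\<And>p. p \<in> convex_cone hull G \<Longrightarrow> e < u \<bullet> p"
      using separating_hyperplane_closed_point[OF convex_convex_cone_hull] by blast
    have "e < 0"
      using u(2)[OF convex_cone_hull_contains_0] by simp
    \<comment> \<open>A generator with a negative value could be rescaled, within the cone, to have value exactly \<open>e\<close>.\<close>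
    have pos: "0 \<le> u \<bullet> p" if "p \<in> G" for p
    proof (rule ccontr)
      assume "\<not> 0 \<le> u \<bullet> p"
      then have "(e / (u \<bullet> p)) *\<^sub>R p \<in> convex_cone hull G"
        using that \<open>e < 0\<close> by (intro convex_cone_hull_mul hull_inc) (auto simp: divide_nonpos_nonpos)
      from u(2)[OF this] \<open>\<not> 0 \<le> u \<bullet> p\<close> show False by simp
    qed
    obtain w t where ut: "u = (w, t)" by (cases u)
    define y where "y = - w"
    define \<tau> where "\<tau> = - t"
    have y: "0 \<le> y"
      using pos[of "(- axis j 1, 0)" for j]
      by (auto simp: G_def ut y_def less_eq_vec_def inner_axis)
    have \<tau>: "0 \<le> \<tau>"
      using pos[of "(0, -1)"] by (simp add: G_def ut \<tau>_def)
    have Ay: "A *v y \<le> \<tau> *\<^sub>R b"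
    proof -
      have "(A *v y) $ i = row i A \<bullet> y" for i
        by (simp add: matrix_vector_mult_def inner_vec_def row_def)
      then show ?thesis
        using pos[of "(row i A, - b $ i)" for i]
        by (auto simp: G_def ut y_def \<tau>_def less_eq_vec_def inner_commute)
    qed
    have cy: "c \<bullet> y > \<tau> * m"
      using u(1) \<open>e < 0\<close> by (simp add: ut y_def \<tau>_def inner_commute)
    show False
    proof (cases "\<tau> = 0")
      case True
      have "c \<bullet> y \<le> 0 \<bullet> x0"
        using y Ay dual True by (intro lp_weak_duality[where A = A]) auto
      with cy True show False by simp
    next
      case False
      then have "\<tau> > 0" using \<tau> by simp
      have "c \<bullet> ((1 / \<tau>) *\<^sub>R y) \<le> m"
      proof (rule bound)
        show "0 \<le> (1 / \<tau>) *\<^sub>R y" using y \<tau> by (auto simp: less_eq_vec_def)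
        show "A *v ((1 / \<tau>) *\<^sub>R y) \<le> b"
          using Ay \<open>\<tau> > 0\<close> by (auto simp: less_eq_vec_def matrix_vector_mult_scaleR field_simps)
      qed
      with cy \<open>\<tau> > 0\<close> show False by (simp add: field_simps)
    qed
  qed
  with hullK show ?thesis by (force simp: K_def)
qed

section \<open>Integral, rational and real packings\<close>

lemma power_exponents_imp_packing:
  fixes v :: "'q::finite \<Rightarrow> nat ^ 's::finite"
  assumes "d \<ge> 1" "d *s \<alpha> \<in> power_exponents v (d * n)"
  shows "\<exists>l :: 'a::linordered_field ^ 'q. 0 \<le> l \<and> incidence_matrix v *v l \<le> of_nat_vec \<alpha> \<and> of_nat n \<le> (\<Sum>j\<in>UNIV. l $ j)"
proof -
  obtain c where c: "d * n \<le> sum c UNIV" "(\<Sum>j\<in>UNIV. c j *s v j) \<le> d *s \<alpha>"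
    using assms(2) by (auto simp: power_exponents_def)
  have d: "0 < (of_nat d :: 'a)" using assms(1) by simp
  define l :: "'a ^ 'q" where "l = (\<chi> j. of_nat (c j) / of_nat d)"
  have "0 \<le> l" by (simp add: l_def less_eq_vec_def)
  moreover have "(incidence_matrix v *v l) $ i \<le> of_nat (\<alpha> $ i)" for i
  proof -
    have "(incidence_matrix v *v l) $ i = of_nat (\<Sum>j\<in>UNIV. c j * v j $ i) / of_nat d"
      by (simp add: l_def matrix_vector_mult_def incidence_matrix_def sum_divide_distrib mult.commute)
    also have "\<dots> \<le> of_nat (d * \<alpha> $ i) / of_nat d"
      using c(2) d by (intro divide_right_mono of_nat_mono) (auto simp: less_eq_vec_def)
    finally show ?thesis using d by simp
  qed
  then have "incidence_matrix v *v l \<le> of_nat_vec \<alpha>"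
    by (simp add: less_eq_vec_def of_nat_vec_def)
  moreover have "of_nat n \<le> (\<Sum>j\<in>UNIV. l $ j)"
  proof -
    have "(of_nat n :: 'a) = of_nat (d * n) / of_nat d" using d by simp
    also have "\<dots> \<le> of_nat (sum c UNIV) / of_nat d"
      using c(1) d by (intro divide_right_mono of_nat_mono) auto
    finally show ?thesis by (simp add: l_def sum_divide_distrib)
  qed
  ultimately show ?thesis by blast
qed

lemma real_packing_of_rat:
  fixes v :: "'q::finite \<Rightarrow> nat ^ 's::finite" and l :: "rat ^ 'q"
  assumes "0 \<le> l" "incidence_matrix v *v l \<le> of_nat_vec \<alpha>" "of_nat n \<le> (\<Sum>j\<in>UNIV. l $ j)"
  shows "\<exists>y :: real ^ 'q. 0 \<le> y \<and> incidence_matrix v *v y \<le> of_nat_vec \<alpha> \<and> real n \<le> (\<Sum>j\<in>UNIV. y $ j)"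
proof (intro exI[of _ "\<chi> j. of_rat (l $ j)"] conjI)
  show "0 \<le> (\<chi> j. real_of_rat (l $ j))"
    using assms(1) by (simp add: less_eq_vec_def)
  have "(incidence_matrix v *v (\<chi> j. real_of_rat (l $ j))) $ i = of_rat ((incidence_matrix v *v l) $ i)" for i
    by (simp add: matrix_vector_mult_def incidence_matrix_def of_rat_sum of_rat_mult)
  moreover have "real_of_rat ((incidence_matrix v *v l) $ i) \<le> of_rat (of_nat (\<alpha> $ i))" for i
    using assms(2) by (simp only: of_rat_less_eq) (simp add: less_eq_vec_def of_nat_vec_def)
  ultimately show "incidence_matrix v *v (\<chi> j. real_of_rat (l $ j)) \<le> of_nat_vec \<alpha>"
    by (simp add: less_eq_vec_def of_nat_vec_def)
  have "real_of_rat (of_nat n) \<le> of_rat (\<Sum>j\<in>UNIV. l $ j)"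
    using assms(3) by (simp only: of_rat_less_eq)
  then show "real n \<le> (\<Sum>j\<in>UNIV. (\<chi> j. real_of_rat (l $ j)) $ j)"
    by (simp add: of_rat_sum)
qed

text \<open>Dirichlet's simultaneous approximation theorem gives a common denominator \<open>d\<close> for which every \<open>d * y $ j\<close> is extremely close
to an integer \<open>c j\<close>. All the inequalities have integral coefficients and integral right-hand sides
after scaling by \<open>d\<close>, so rounding, which costs each of them less than \<open>1\<close>, preserves them.\<close>

lemma integral_solution_of_scaled_packing:
  fixes v :: "'q::finite \<Rightarrow> nat ^ 's::finite" and y :: "real ^ 'q"
  assumes y: "0 \<le> y" "incidence_matrix v *v y \<le> of_nat_vec \<alpha>" and n: "real n \<le> (\<Sum>j\<in>UNIV. y $ j)"
  shows "\<exists>d\<ge>1. d *s \<alpha> \<in> power_exponents v (d * n)"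
proof -
  \<comment> \<open>An error \<open>1 / N\<close> per coordinate adds up to less than \<open>1\<close> in each inequality.\<close>
  define N where "N = 1 + CARD('q) + (\<Sum>i\<in>UNIV. \<Sum>j\<in>UNIV. v j $ i)"
  have "N > 0" by (simp add: N_def)
  obtain h where h: "bij_betw h {..<CARD('q)} (UNIV :: 'q set)"
    using ex_bij_betw_nat_finite[of "UNIV :: 'q set"] by (auto simp: atLeast0LessThan)
  obtain q p where q: "0 < q" and "\<And>k. k < CARD('q) \<Longrightarrow> \<bar>of_int q * y $ h k - of_int (p k)\<bar> < 1 / N"
    using Dirichlet_approx_simult[OF \<open>N > 0\<close>, of "CARD('q)" "\<lambda>k. y $ h k"] by metis
  moreover define z where "z j = p (inv_into {..<CARD('q)} h j)" for j
  ultimately have z: "\<bar>of_int q * y $ j - of_int (z j)\<bar> < 1 / N" for j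
    by (metis UNIV_I bij_betw_imp_surj_on f_inv_into_f h inv_into_into lessThan_iff)
  \<comment> \<open>Nonnegativity too survives rounding: an integer above \<open>-1\<close> is nonnegative.\<close>
  have "z j \<ge> 0" for j
  proof -
    have "0 \<le> of_int q * y $ j" using y(1) q by (auto simp: less_eq_vec_def)
    moreover have "1 / real N \<le> 1" using \<open>N > 0\<close> by simp
    ultimately have "of_int (z j) > (-1 :: real)" using z[of j] by linarith
    then show ?thesis by linarith
  qed
  define c where "c j = nat (z j)" for j
  define d where "d = nat q"
  have cz: "real (c j) = of_int (z j)" for j using \<open>z j \<ge> 0\<close> by (simp add: c_def)
  have dq: "real d = of_int q" using q by (simp add: d_def)
  have close: "\<bar>d * y $ j - c j\<bar> \<le> 1 / N" for j
    using z[of j] by (simp add: cz dq)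
  have "d * n \<le> sum c UNIV"
  proof -
    have "d * y $ j - 1 / N \<le> c j" for j using close[of j] by linarith
    then have "(\<Sum>j\<in>UNIV. d * y $ j - 1 / N) \<le> (\<Sum>j\<in>UNIV. real (c j))"
      by (intro sum_mono)
    moreover have "(\<Sum>j\<in>UNIV. d * y $ j - 1 / N) = d * (\<Sum>j\<in>UNIV. y $ j) - CARD('q) / N"
      by (simp add: sum_subtractf sum_distrib_left)
    moreover have "real d * n \<le> d * (\<Sum>j\<in>UNIV. y $ j)"
      using n by (intro mult_left_mono) auto
    moreover have "CARD('q) / real N < 1"
    proof -
      have "real CARD('q) < real N" unfolding of_nat_less_iff by (simp add: N_def)
      with \<open>N > 0\<close> show ?thesis by simp
    qed
    ultimately have "real d * n - 1 < (\<Sum>j\<in>UNIV. real (c j))" by linarith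
    then have "real (d * n) < real (sum c UNIV + 1)" by simp
    then show ?thesis by linarith
  qed
  moreover have "(\<Sum>j\<in>UNIV. c j * v j $ i) \<le> d * \<alpha> $ i" for i
  proof -
    have "real (c j) \<le> d * y $ j + 1 / N" for j using close[of j] by linarith
    then have "(\<Sum>j\<in>UNIV. real (c j) * v j $ i) \<le> (\<Sum>j\<in>UNIV. (d * y $ j + 1 / N) * v j $ i)"
      by (intro sum_mono mult_right_mono) auto
    also have "\<dots> = d * (\<Sum>j\<in>UNIV. v j $ i * y $ j) + (\<Sum>j\<in>UNIV. v j $ i) / N"
      by (simp add: sum.distrib sum_distrib_left sum_divide_distrib algebra_simps)
    also have "(\<Sum>j\<in>UNIV. v j $ i * y $ j) \<le> \<alpha> $ i"
      using y(2) by (auto simp: less_eq_vec_def matrix_vector_mult_def incidence_matrix_def of_nat_vec_def)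
    also have "(\<Sum>j\<in>UNIV. v j $ i) / real N < 1"
    proof -
      have "(\<Sum>j\<in>UNIV. v j $ i) \<le> (\<Sum>i\<in>UNIV. \<Sum>j\<in>UNIV. v j $ i)"
        by (rule member_le_sum) auto
      then have "(\<Sum>j\<in>UNIV. v j $ i) < N" by (simp add: N_def)
      then have "real (\<Sum>j\<in>UNIV. v j $ i) < real N" by (simp only: of_nat_less_iff)
      moreover have "0 < real N" using \<open>N > 0\<close> by simp
      ultimately show ?thesis by (subst divide_less_eq_1_pos)
    qed
    finally have "(\<Sum>j\<in>UNIV. real (c j) * v j $ i) < d * real (\<alpha> $ i) + 1"
      by (simp add: mult_left_mono)
    then have "real (\<Sum>j\<in>UNIV. c j * v j $ i) < real (d * \<alpha> $ i + 1)" by simp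
    then show ?thesis by linarith
  qed
  moreover have "d \<ge> 1" using q by (simp add: d_def)
  ultimately show ?thesis by (auto simp: power_exponents_def less_eq_vec_def)
qed

section \<open>The packing program and its dual\<close>

text \<open>Each column has a positive, hence at least unit, entry, which bounds the corresponding
coordinate of \<open>y\<close>; the feasible set is therefore compact.\<close>

lemma packing_max_attained:
  fixes v :: "'q::finite \<Rightarrow> nat ^ 's::finite"
  assumes "\<And>j. v j \<noteq> 0"
  shows "\<exists>m. is_max_of m {y \<bullet> 1 | y :: real ^ 'q. 0 \<le> y \<and> incidence_matrix v *v y \<le> of_nat_vec \<alpha>}"
proof -
  define P where "P = {y :: real ^ 'q. 0 \<le> y \<and> incidence_matrix v *v y \<le> of_nat_vec \<alpha>}"
  have "y $ j \<le> (\<Sum>i\<in>UNIV. \<alpha> $ i)" if "y \<in> P" for y j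
  proof -
    obtain i where "v j $ i \<noteq> 0" using assms[of j] by (auto simp: vec_eq_iff)
    have y: "0 \<le> y $ j" for j using that by (auto simp: P_def less_eq_vec_def)
    have "y $ j \<le> v j $ i * y $ j"
      using mult_right_mono[of 1 "real (v j $ i)" "y $ j"] \<open>v j $ i \<noteq> 0\<close> y by simp
    also have "\<dots> \<le> (\<Sum>j\<in>UNIV. v j $ i * y $ j)"
      by (rule member_le_sum) (auto simp: y)
    also have "\<dots> \<le> \<alpha> $ i"
      using that by (auto simp: P_def less_eq_vec_def matrix_vector_mult_def incidence_matrix_def of_nat_vec_def)
    also have "\<alpha> $ i \<le> (\<Sum>i\<in>UNIV. \<alpha> $ i)"
      by (rule member_le_sum) auto
    finally show ?thesis by simp
  qed
  then have "P \<subseteq> cbox 0 (\<chi> j. \<Sum>i\<in>UNIV. \<alpha> $ i)"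
    by (auto simp: P_def mem_box_cart less_eq_vec_def)
  then have "bounded P" by (rule bounded_subset[OF bounded_cbox])
  moreover have "closed P"
    unfolding P_def less_eq_vec_def
    by (intro closed_Collect_conj closed_Collect_all closed_Collect_le continuous_intros)
  ultimately have "compact P" by (simp add: compact_eq_bounded_closed)
  moreover have "0 \<in> P" by (auto simp: P_def less_eq_vec_def of_nat_vec_def)
  ultimately obtain y where "y \<in> P" "\<And>z. z \<in> P \<Longrightarrow> z \<bullet> 1 \<le> y \<bullet> 1"
    using continuous_attains_sup[of P "\<lambda>y. y \<bullet> 1"] by (force intro: continuous_intros)
  then show ?thesis
    by (intro exI[of _ "y \<bullet> 1"]) (auto simp: is_max_of_def P_def)
qed

text \<open>The constant vector \<open>1\<close> is feasible for the dual program because the columns are nonzero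
and integral, so strong duality applies with the bound given by the maximum.\<close>

lemma packing_max_is_covering_min:
  fixes v :: "'q::finite \<Rightarrow> nat ^ 's::finite"
  assumes "\<And>j. v j \<noteq> 0"
    and m: "is_max_of m {y \<bullet> 1 | y :: real ^ 'q. 0 \<le> y \<and> incidence_matrix v *v y \<le> of_nat_vec \<alpha>}"
  shows "is_min_of m {of_nat_vec \<alpha> \<bullet> x | x :: real ^ 's. 0 \<le> x \<and> x v* incidence_matrix v \<ge> 1}"
proof -
  let ?A = "incidence_matrix v :: real ^ 'q ^ 's" and ?b = "of_nat_vec \<alpha> :: real ^ 's"
  obtain y where y: "0 \<le> y" "?A *v y \<le> ?b" "m = 1 \<bullet> y"
    using m by (auto simp: is_max_of_def inner_commute)
  have weak: "m \<le> ?b \<bullet> x" if "0 \<le> x" "1 \<le> x v* ?A" for x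
    using lp_weak_duality[OF y(1,2) that] y(3) by simp
  have "1 \<le> 1 v* ?A"
  proof -
    have "1 \<le> (\<Sum>i\<in>UNIV. real (v j $ i))" for j
    proof -
      have "(\<Sum>i\<in>UNIV. v j $ i) \<noteq> 0" using assms(1)[of j] by (auto simp: vec_eq_iff)
      then have "1 \<le> real (\<Sum>i\<in>UNIV. v j $ i)" by linarith
      then show ?thesis by simp
    qed
    then show ?thesis
      by (simp add: less_eq_vec_def vector_matrix_mult_def incidence_matrix_def)
  qed
  then have "\<exists>x\<ge>0. 1 \<le> x v* ?A \<and> ?b \<bullet> x \<le> m"
  proof (rule lp_strong_duality[rotated])
    show "0 \<le> (1 :: real ^ 's)" by (simp add: less_eq_vec_def)
    show "1 \<bullet> y \<le> m" if "0 \<le> y" "?A *v y \<le> ?b" for y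
      using m that unfolding is_max_of_def by (auto simp: inner_commute)
  qed
  then obtain x where "0 \<le> x" "1 \<le> x v* ?A" "?b \<bullet> x = m"
    using weak by (metis order_antisym)
  with weak show ?thesis
    unfolding is_min_of_def by blast
qed

theorem proposition3p3:
  fixes I :: "((nat ^ 's::finite) \<Rightarrow>\<^sub>0 'k::field) set"
    and v :: "'q::finite \<Rightarrow> nat ^ 's"
    and \<alpha> :: "nat ^ 's"
    and n :: nat
  assumes "minimal_monomial_generators (range (\<lambda>j. mon (v j))) I"
    and "inj v"
    and "\<And>j. v j \<noteq> 0"
    and "n \<ge> 1"
  shows
    "(mon \<alpha> \<in> ideal_integral_closure (ideal_power I n)
        \<longleftrightarrow> (\<exists>l :: rat ^ 'q. 0 \<le> l \<and> incidence_matrix v *v l \<le> of_nat_vec \<alpha>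
              \<and> (\<Sum>j\<in>UNIV. l $ j) \<ge> of_nat n))
     \<and> ((\<exists>l :: rat ^ 'q. 0 \<le> l \<and> incidence_matrix v *v l \<le> of_nat_vec \<alpha>
              \<and> (\<Sum>j\<in>UNIV. l $ j) \<ge> of_nat n)
        \<longleftrightarrow> (\<exists>m :: real.
              is_max_of m {y \<bullet> 1 | y :: real ^ 'q.
                             0 \<le> y \<and> incidence_matrix v *v y \<le> of_nat_vec \<alpha>}
            \<and> is_min_of m {of_nat_vec \<alpha> \<bullet> x | x :: real ^ 's.
                             0 \<le> x \<and> x v* incidence_matrix v \<ge> 1}
            \<and> m \<ge> real n))"
    (is "(?closure \<longleftrightarrow> ?rational) \<and> (?rational \<longleftrightarrow> ?duality)")
proof -
  define E where "E \<longleftrightarrow> (\<exists>d\<ge>1. d *s \<alpha> \<in> power_exponents v (d * n))"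
  define R where "R \<longleftrightarrow> (\<exists>y :: real ^ 'q. 0 \<le> y \<and> incidence_matrix v *v y \<le> of_nat_vec \<alpha>
    \<and> real n \<le> (\<Sum>j\<in>UNIV. y $ j))"
  have "?closure \<longleftrightarrow> E"
    using assms(1) mon_in_integral_closure_iff[of \<alpha> v n]
    by (auto simp: E_def minimal_monomial_generators_def)
  moreover have "E \<Longrightarrow> ?rational"
    unfolding E_def using power_exponents_imp_packing by blast
  moreover have "?rational \<Longrightarrow> R"
    unfolding R_def using real_packing_of_rat by blast
  moreover have "R \<Longrightarrow> E"
    unfolding R_def E_def using integral_solution_of_scaled_packing by blast
  moreover have "R \<longleftrightarrow> ?duality"
  proof
    assume R
    then obtain y :: "real ^ 'q" where y: "0 \<le> y" "incidence_matrix v *v y \<le> of_nat_vec \<alpha>"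
        "real n \<le> y \<bullet> 1"
      by (auto simp: R_def inner_vec_def)
    obtain m where m: "is_max_of m {y \<bullet> 1 | y :: real ^ 'q. 0 \<le> y \<and> incidence_matrix v *v y \<le> of_nat_vec \<alpha>}"
      using packing_max_attained[of v \<alpha>] assms(3) by blast
    then have "y \<bullet> 1 \<le> m"
      using y by (auto simp: is_max_of_def)
    with y(3) m packing_max_is_covering_min[of v m \<alpha>] assms(3) show ?duality by (intro exI[of _ m]) auto
  next
    assume ?duality
    then show R by (force simp: R_def is_max_of_def inner_vec_def)
  qed
  ultimately show ?thesis by blast
qed

end
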